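(* For every $\beta>0$ there is a constant $C_\beta$ such that for every sequence $a=\{a_j\}_{j\in\mathbb{Z}^2}$ of complex numbers for which the right-hand side is finite, $$\|F(a)\|_{l^2}\le C_\beta\,\|a\|_{l^2}^2\,\|a\|_{h^\beta},$$ and $$\|F(a)\|_{h^1}\le C_\beta\,\|a\|_{h^1}\,\|a\|_{h^\beta}\,\|a\|_{l^2}.$$
   Context: For a complex sequence $a=\{a_j\}_{j\in\mathbb{Z}^2}$, $\|a\|_{l^2}^2=\sum_{j\in\mathbb{Z}^2}|a_j|^2$ and $\|a\|_{h^s}^2=\sum_{j\in\mathbb{Z}^2}\langle j\rangle^{2s}|a_j|^2$, with $\langle j\rangle=(1+|j|^2)^{1/2}$. The cubic resonant nonlinearity is $F(a)=\{f_j\}_{j\in\mathbb{Z}^2}$ with $$f_j=\sum_{(j_1,j_2,j_3)\in R(j)}a_{j_1}\bar a_{j_2}a_{j_3},$$ $$R(j)=\{(j_1,j_2,j_3)\in(\mathbb{Z}^2)^3:\ j_1-j_2+j_3=j,\ |j_1|^2-|j_2|^2+|j_3|^2=|j|^2\}.$$ *)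

theory Defs
  imports "HOL-Analysis.Analysis"
begin

type_synonym Z2 = "int \<times> int"

definition sqlen :: "Z2 \<Rightarrow> int" where
  "sqlen j = (fst j)\<^sup>2 + (snd j)\<^sup>2"

definition bracket :: "Z2 \<Rightarrow> real" where
  "bracket j = sqrt (1 + of_int (sqlen j))"

(* The two norms below are real-valued: they are the norms of the text only on the
   sequences satisfying the membership predicates in_l2 and in_h, since an infinite sum
   that does not converge has the value 0. *)

definition in_l2 :: "(Z2 \<Rightarrow> complex) \<Rightarrow> bool" where
  "in_l2 a \<longleftrightarrow> (\<lambda>j. (cmod (a j))\<^sup>2) summable_on UNIV"

definition l2_norm :: "(Z2 \<Rightarrow> complex) \<Rightarrow> real" where
  "l2_norm a = sqrt (\<Sum>\<^sub>\<infinity>j. (cmod (a j))\<^sup>2)"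

definition in_h :: "real \<Rightarrow> (Z2 \<Rightarrow> complex) \<Rightarrow> bool" where
  "in_h s a \<longleftrightarrow> (\<lambda>j. bracket j powr (2 * s) * (cmod (a j))\<^sup>2) summable_on UNIV"

definition h_norm :: "real \<Rightarrow> (Z2 \<Rightarrow> complex) \<Rightarrow> real" where
  "h_norm s a = sqrt (\<Sum>\<^sub>\<infinity>j. bracket j powr (2 * s) * (cmod (a j))\<^sup>2)"

definition R :: "Z2 \<Rightarrow> (Z2 \<times> Z2 \<times> Z2) set" where
  "R j = {(j1, j2, j3). j1 - j2 + j3 = j \<and> sqlen j1 - sqlen j2 + sqlen j3 = sqlen j}"

definition F_term :: "(Z2 \<Rightarrow> complex) \<Rightarrow> Z2 \<times> Z2 \<times> Z2 \<Rightarrow> complex" where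
  "F_term a = (\<lambda>(j1, j2, j3). a j1 * cnj (a j2) * a j3)"

definition F :: "(Z2 \<Rightarrow> complex) \<Rightarrow> Z2 \<Rightarrow> complex" where
  "F a j = (\<Sum>\<^sub>\<infinity>t\<in>R j. F_term a t)"

(* R j is infinite, so F a is meaningful only if all the defining sums converge
   (for complex terms, summable_on is absolute convergence). *)
definition F_defined :: "(Z2 \<Rightarrow> complex) \<Rightarrow> bool" where
  "F_defined a \<longleftrightarrow> (\<forall>j. F_term a summable_on R j)"

end

theory Submission
  imports Defs "HOL-Computational_Algebra.Primes"
begin

text \<open>
  A triple in \<open>R j\<close> is a rectangle \<open>j2, j1, j, j3\<close> with diagonals \<open>(j2, j)\<close> and \<open>(j1, j3)\<close>.  Let \<open>L\<close>
  be its shorter side.  The rectangles on a given diagonal correspond to the lattice points of a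
  circle, and the sum of \<open>\<langle>L\<rangle> powr -\<beta>\<close> over them is bounded uniformly in the diagonal.
  Cauchy--Schwarz, with one factor summed over each diagonal, therefore bounds the sum of
  \<open>\<langle>L\<rangle> powr -\<beta> * x j1 * y j2 * z j3\<close> over \<open>R j\<close> in \<open>l2\<close> by the product of the three \<open>l2\<close> norms.

  The weight costs a single \<open>h\<^sup>\<beta>\<close> norm, because \<open>L\<close> is at most \<open>|j2| + |j3|\<close> and at most
  \<open>|j1| + |j2|\<close>.  Derivatives fall on \<open>j1\<close> or \<open>j3\<close>, because \<open>|j|\<^sup>2 \<le> |j1|\<^sup>2 + |j3|\<^sup>2\<close>; whichever
  of the two carries them, the factor \<open>\<langle>\<cdot>\<rangle> powr \<beta>\<close> can be put on one of the other two.
\<close>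

subsection \<open>The divisor bound\<close>

text \<open>A divisor of a product splits into divisors of the two factors, and a divisor of
  \<open>p ^ e\<close> is one of the \<open>e + 1\<close> powers \<open>p ^ i\<close>.\<close>

lemma card_divisors_prime_power_mult:
  fixes p m e :: nat
  assumes "prime p" "m > 0"
  shows "card {d. d dvd p ^ e * m} \<le> (e + 1) * card {d. d dvd m}"
proof -
  have "{d. d dvd p ^ e * m} \<subseteq> (\<lambda>(i, d). p ^ i * d) ` ({..e} \<times> {d. d dvd m})"
  proof
    fix d assume "d \<in> {d. d dvd p ^ e * m}"
    then obtain b c where "d = b * c" "b dvd p ^ e" "c dvd m"
      using division_decomp by blast
    moreover obtain i where "i \<le> e" "b = p ^ i"
      using divides_primepow_nat[OF assms(1)] \<open>b dvd p ^ e\<close> by blast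
    ultimately show "d \<in> (\<lambda>(i, d). p ^ i * d) ` ({..e} \<times> {d. d dvd m})" by auto
  qed
  then have "card {d. d dvd p ^ e * m} \<le> card ({..e} \<times> {d. d dvd m})"
    using assms by (intro surj_card_le) (auto intro: finite_divisors_nat)
  then show ?thesis by (simp add: card_cartesian_product)
qed

text \<open>With \<open>x = \<epsilon> * e * ln 2\<close>, the inequality
  \<open>1 + x \<le> exp x\<close> bounds both \<open>1\<close> and \<open>x\<close> by
  \<open>(p ^ e) powr \<epsilon>\<close>; the two summands of the constant come from these two
  bounds.\<close>

lemma Suc_le_exp_factor:
  fixes \<epsilon> :: real
  assumes "\<epsilon> > 0" "p \<ge> (2::nat)"
  shows "real e + 1 \<le> (1 + 1 / (\<epsilon> * ln 2)) * (real p ^ e) powr \<epsilon>"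
proof -
  let ?x = "\<epsilon> * (real e * ln 2)"
  have "1 + ?x \<le> exp ?x" by (rule exp_ge_add_one_self)
  moreover have "0 \<le> ?x" using assms by simp
  moreover have "exp ?x = 2 powr (real e * \<epsilon>)" by (simp add: powr_def mult_ac)
  moreover have "2 powr (real e * \<epsilon>) \<le> real p powr (real e * \<epsilon>)"
    using assms by (intro powr_mono2) auto
  moreover have "real p powr (real e * \<epsilon>) = (real p ^ e) powr \<epsilon>"
    using assms by (simp add: powr_powr flip: powr_realpow)
  ultimately have *: "1 \<le> (real p ^ e) powr \<epsilon>" "?x \<le> (real p ^ e) powr \<epsilon>" by linarith+
  from *(2) have "real e \<le> 1 / (\<epsilon> * ln 2) * (real p ^ e) powr \<epsilon>"
    using assms by (simp add: field_simps)
  with *(1) show ?thesis by (simp add: algebra_simps)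
qed


text \<open>Induction strips off one prime power \<open>p ^ e\<close> at a time. If
  \<open>p powr \<epsilon> \<ge> 2\<close>, then
  \<open>e + 1 \<le> 2 ^ e \<le> (p ^ e) powr \<epsilon>\<close> costs no constant; a smaller prime
  costs one factor \<open>M\<close>. The exponent of \<open>M\<close> therefore counts the small
  primes dividing \<open>n\<close>.\<close>

lemma card_divisors_le_primes:
  fixes \<epsilon> :: real and n :: nat
  assumes \<epsilon>: "\<epsilon> > 0" and n: "n > 0"
  defines "M \<equiv> 1 + 1 / (\<epsilon> * ln 2)"
  shows "real (card {d. d dvd n}) \<le>
           M ^ card {p. prime p \<and> p dvd n \<and> real p < 2 powr (1 / \<epsilon>)} * real n powr \<epsilon>"
  using n
proof (induction n rule: less_induct)
  case (less n)
  show ?case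
  proof (cases "n = 1")
    case False
    then obtain p where p: "prime p" "p dvd n" using prime_factor_nat by blast
    define e where "e = multiplicity p n"
    obtain m where nm: "n = p ^ e * m" and pm: "\<not> p dvd m"
      unfolding e_def using multiplicity_decompose'[of n p] p less.prems
      by (metis not_prime_unit neq0_conv)
    have e: "e > 0" using p nm pm by (cases e) auto
    have m: "m > 0" using nm less.prems by (cases m) auto
    have p2: "p \<ge> 2" using p(1) by (rule prime_ge_2_nat)
    have mn: "m < n" using nm e m p2 one_less_power[of p e] by simp
    let ?P = "\<lambda>n. {p. prime p \<and> p dvd n \<and> real p < 2 powr (1 / \<epsilon>)}"
    have fin: "finite (?P n)" using less.prems by (auto intro: finite_subset[OF _ finite_divisors_nat[of n]])
    have M1: "M \<ge> 1" using \<epsilon> by (simp add: M_def)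
    have sub: "?P m \<subseteq> ?P n" using nm by auto
    have "real (card {d. d dvd n}) \<le> (real e + 1) * real (card {d. d dvd m})"
      using of_nat_mono[OF card_divisors_prime_power_mult[OF p(1) m, of e, folded nm], where 'a = real]
      by (simp add: algebra_simps)
    also have "\<dots> \<le> (real e + 1) * (M ^ card (?P m) * real m powr \<epsilon>)"
      using less.IH[OF mn m] by (intro mult_left_mono) auto
    finally have step: "real (card {d. d dvd n}) \<le> (real e + 1) * (M ^ card (?P m) * real m powr \<epsilon>)" .
    have "(real e + 1) * M ^ card (?P m) \<le> (real p ^ e) powr \<epsilon> * M ^ card (?P n)"
    proof (cases "real p < 2 powr (1 / \<epsilon>)")
      case True
      \<comment> \<open>\<open>p\<close> is counted for \<open>n\<close> but not for
        \<open>m\<close>, so the exponent grows by one and pays for the factor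
        \<open>M\<close>.\<close>
      then have "p \<in> ?P n - ?P m" using p pm by auto
      then have "Suc (card (?P m)) \<le> card (?P n)"
        using sub fin by (metis (no_types, lifting) DiffD1 DiffD2 Suc_leI psubsetI psubset_card_mono)
      then have "M ^ Suc (card (?P m)) \<le> M ^ card (?P n)" using M1 by (intro power_increasing)
      moreover have "real e + 1 \<le> M * (real p ^ e) powr \<epsilon>"
        unfolding M_def using Suc_le_exp_factor[OF \<epsilon> p2] .
      then have "(real e + 1) * M ^ card (?P m) \<le> (M * (real p ^ e) powr \<epsilon>) * M ^ card (?P m)"
        using M1 by (intro mult_right_mono) auto
      moreover have "(real p ^ e) powr \<epsilon> * M ^ Suc (card (?P m)) \<le> (real p ^ e) powr \<epsilon> * M ^ card (?P n)"
        using calculation(1) by (rule mult_left_mono) simp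
      ultimately show ?thesis by (simp add: mult_ac)
    next
      case False
      have "2 = (2 powr (1 / \<epsilon>)) powr \<epsilon>" using \<epsilon> by (simp add: powr_powr)
      also have "\<dots> \<le> real p powr \<epsilon>" using False \<epsilon> by (intro powr_mono2) auto
      finally have "2 ^ e \<le> (real p powr \<epsilon>) ^ e" by (intro power_mono) auto
      also have "\<dots> = (real p ^ e) powr \<epsilon>"
        using p2 by (simp add: powr_powr mult.commute flip: powr_realpow)
      also have "real e + 1 \<le> 2 ^ e"
        using of_nat_mono[OF Suc_leI[OF less_exp[of e]], where 'a = real] by (simp add: add.commute)
      finally have "real e + 1 \<le> (real p ^ e) powr \<epsilon>" by linarith
      moreover have "M ^ card (?P m) \<le> M ^ card (?P n)"
        using M1 by (intro power_increasing card_mono fin sub)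
      ultimately show ?thesis using M1 by (intro mult_mono) auto
    qed
    then have "((real e + 1) * M ^ card (?P m)) * real m powr \<epsilon>
        \<le> ((real p ^ e) powr \<epsilon> * M ^ card (?P n)) * real m powr \<epsilon>"
      by (rule mult_right_mono) simp
    then have "(real e + 1) * (M ^ card (?P m) * real m powr \<epsilon>)
        \<le> M ^ card (?P n) * ((real p ^ e) powr \<epsilon> * real m powr \<epsilon>)"
      by (simp only: mult_ac)
    also have "(real p ^ e) powr \<epsilon> * real m powr \<epsilon> = real n powr \<epsilon>"
      by (simp add: nm powr_mult)
    finally show ?thesis using step by simp
  qed (use \<epsilon> in \<open>simp add: M_def one_le_power\<close>)
qed

text \<open>Only primes below \<open>2 powr (1 / \<epsilon>)\<close> contribute a factor, and there
  are at most \<open>B\<close> of them whatever \<open>n\<close> is.\<close>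

lemma divisor_bound:
  fixes \<epsilon> :: real
  assumes \<epsilon>: "\<epsilon> > 0"
  shows "\<exists>C. \<forall>n>0. real (card {d. d dvd n}) \<le> C * real n powr \<epsilon>"
proof -
  define M where "M = 1 + 1 / (\<epsilon> * ln 2)"
  define B where "B = nat \<lceil>2 powr (1 / \<epsilon>)\<rceil>"
  have M1: "M \<ge> 1" using \<epsilon> by (simp add: M_def)
  have "real (card {d. d dvd n}) \<le> M ^ B * real n powr \<epsilon>" if "n > 0" for n
  proof -
    let ?P = "{p. prime p \<and> p dvd n \<and> real p < 2 powr (1 / \<epsilon>)}"
    have "?P \<subseteq> {..<B}" unfolding B_def by (auto, linarith)
    then have "card ?P \<le> B" using card_mono[of "{..<B}" ?P] by simp
    then have "M ^ card ?P \<le> M ^ B" using M1 by (rule power_increasing)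
    then show ?thesis
      using card_divisors_le_primes[OF \<epsilon> that]
      by (smt (verit) M_def mult_right_mono powr_ge_zero)
  qed
  then show ?thesis by blast
qed

subsection \<open>Representations as a sum of two squares\<close>

text \<open>Fix one representation \<open>(x0, y0)\<close>.  Any other makes \<open>(x * y0 - x0 * y) * (x * y0 + x0 * y)\<close> a
  multiple of \<open>n\<close>, and how \<open>n\<close> splits over the two factors determines \<open>(x, y)\<close> up to boundedly many
  choices.\<close>

lemma same_gcd_imp_dvd_cross:
  fixes x y x' y' x0 y0 n :: int
  assumes z: "x\<^sup>2 + y\<^sup>2 = n" "coprime x y"
    and z': "x'\<^sup>2 + y'\<^sup>2 = n"
    and z0: "x0\<^sup>2 + y0\<^sup>2 = n" "coprime x0 y0"
    and eq: "gcd (x * y0 - x0 * y) n = gcd (x' * y0 - x0 * y') n"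
  shows "n dvd 2 * (x * y' - x' * y)"
proof -
  define d where "d = gcd (x * y0 - x0 * y) n"
  \<comment> \<open>Modulo \<open>b\<close>, \<open>n\<close> is congruent to
    \<open>a\<^sup>2\<close>, which is coprime to \<open>b\<close>.\<close>
  have cop: "coprime b n" if "a\<^sup>2 + b\<^sup>2 = n" "coprime a b" for a b
  proof -
    have "coprime b (a\<^sup>2)" using that by (simp add: coprime_commute)
    then show ?thesis
      using that(1) gcd_add_mult[of b b "a\<^sup>2"]
      by (simp add: coprime_iff_gcd_eq_1 power2_eq_square[of b] add.commute)
  qed
  have cx: "coprime x n" using cop[of y x] z by (simp add: add.commute coprime_commute)
  have cy0: "coprime y0 n" using cop[of x0 y0] z0 by simp
  have dn: "d dvd n" and dP: "d dvd x * y0 - x0 * y" and dP': "d dvd x' * y0 - x0 * y'"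
    unfolding d_def by (simp, simp, simp add: eq)
  \<comment> \<open>\<open>n\<close> divides the product of the two cross terms, and Bezout replaces
    the first of them by its gcd with \<open>n\<close>.\<close>
  have ndQ: "n dvd gcd (a * y0 - x0 * b) n * (a * y0 + x0 * b)" if "a\<^sup>2 + b\<^sup>2 = n" for a b
  proof -
    have "(a * y0 - x0 * b) * (a * y0 + x0 * b) = n * (a\<^sup>2 + y0\<^sup>2 - n)"
    proof -
      have "(a * y0 - x0 * b) * (a * y0 + x0 * b) = a\<^sup>2 * y0\<^sup>2 - x0\<^sup>2 * b\<^sup>2"
        by (simp add: power2_eq_square algebra_simps)
      also have "\<dots> = a\<^sup>2 * y0\<^sup>2 - (n - y0\<^sup>2) * (n - a\<^sup>2)"
        using that z0(1) by (metis add_diff_cancel_left' add_diff_cancel_right')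
      also have "\<dots> = n * (a\<^sup>2 + y0\<^sup>2 - n)" by (simp add: algebra_simps)
      finally show ?thesis .
    qed
    then have "n dvd (a * y0 - x0 * b) * (a * y0 + x0 * b)" by simp
    moreover obtain u v where uv: "u * (a * y0 - x0 * b) + v * n = gcd (a * y0 - x0 * b) n"
      using bezout_int by blast
    then have "gcd (a * y0 - x0 * b) n * (a * y0 + x0 * b) =
        u * ((a * y0 - x0 * b) * (a * y0 + x0 * b)) + n * (v * (a * y0 + x0 * b))"
      unfolding uv[symmetric] by (simp add: algebra_simps)
    ultimately show ?thesis by simp
  qed
  have Q: "n dvd d * (x * y0 + x0 * y)" "n dvd d * (x' * y0 + x0 * y')"
    using ndQ[OF z(1)] ndQ[OF z'] eq unfolding d_def by simp_all
  let ?X = "x * y' - x' * y"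
  have "y0 * ?X = y' * (x * y0 - x0 * y) - y * (x' * y0 - x0 * y')" by algebra
  then have "d dvd y0 * ?X" using dP dP' by simp
  moreover have "coprime d y0" using cy0 dn by (meson coprime_commute coprime_divisors dvd_refl)
  ultimately have dX: "d dvd ?X" by (simp add: coprime_dvd_mult_right_iff)
  have "y0 * (d * ?X) = y' * (d * (x * y0 + x0 * y)) - y * (d * (x' * y0 + x0 * y'))" by algebra
  then have "n dvd y0 * (d * ?X)" using Q by simp
  then have ndX: "n dvd d * ?X" using cy0 by (simp add: coprime_commute coprime_dvd_mult_right_iff)
  obtain e where e: "n = d * e" using dn by blast
  show ?thesis
  proof (cases "d = 0")
    case True
    then have "n = 0" using e by simp
    then show ?thesis using z z' by (simp add: sum_power2_eq_zero_iff)
  next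
    case False
    have eX: "e dvd ?X" and eQ: "e dvd x * y0 + x0 * y"
      using ndX Q(1) e False by simp_all
    \<comment> \<open>A common factor of \<open>d\<close> and \<open>e\<close> divides
      \<open>2 * x * y0\<close>, the sum of the two cross terms, but is coprime to \<open>x\<close>
      and \<open>y0\<close>, so it divides \<open>2\<close>. As
      \<open>n = gcd d e * lcm d e\<close>, this is the origin of the factor \<open>2\<close> in the
      conclusion.\<close>
    let ?c = "gcd d e"
    have "?c dvd (x * y0 - x0 * y) + (x * y0 + x0 * y)"
      using dP eQ by (meson dvd_add dvd_trans gcd_dvd1 gcd_dvd2)
    also have "(x * y0 - x0 * y) + (x * y0 + x0 * y) = x * (y0 * 2)" by simp
    finally have "?c dvd x * (y0 * 2)" .
    moreover have "?c dvd n" using e by simp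
    then have "coprime ?c x" "coprime ?c y0"
      using cx cy0 by (meson coprime_commute coprime_divisors dvd_refl)+
    ultimately have c2: "?c dvd 2" by (simp add: coprime_dvd_mult_right_iff)
    have "lcm d e dvd ?X" using dX eX by simp
    then have "?c * lcm d e dvd 2 * ?X" using c2 by (rule mult_dvd_mono[rotated])
    then show ?thesis by (simp add: e gcd_mult_lcm flip: abs_mult) 
  qed
qed

text \<open>The dot and cross products with \<open>(x, y)\<close> have squares adding up to
  \<open>n\<^sup>2\<close>. So twice the cross product divided by \<open>n\<close> is one of five
  integers; together with the sign of the dot product (three values) it fixes both products and
  hence the point. This gives \<open>15 = 5 * 3\<close>.\<close>

lemma card_dvd_cross_le:
  fixes x y n :: int
  assumes n: "n > 0" and z: "x\<^sup>2 + y\<^sup>2 = n"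
  shows "finite {(x', y'). x'\<^sup>2 + y'\<^sup>2 = n \<and> n dvd 2 * (x * y' - x' * y)} \<and>
         card {(x', y'). x'\<^sup>2 + y'\<^sup>2 = n \<and> n dvd 2 * (x * y' - x' * y)} \<le> 15"
proof -
  let ?S = "{(x', y'). x'\<^sup>2 + y'\<^sup>2 = n \<and> n dvd 2 * (x * y' - x' * y)}"
  let ?f = "\<lambda>(x', y'). (2 * (x * y' - x' * y) div n, sgn (x * x' + y * y'))"
  have norm: "(x * x' + y * y')\<^sup>2 + (x * y' - x' * y)\<^sup>2 = n\<^sup>2" if "x'\<^sup>2 + y'\<^sup>2 = n" for x' y'
  proof -
    have "(x * x' + y * y')\<^sup>2 + (x * y' - x' * y)\<^sup>2 = (x\<^sup>2 + y\<^sup>2) * (x'\<^sup>2 + y'\<^sup>2)"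
      by (simp add: power2_eq_square algebra_simps)
    then show ?thesis using that z by (simp add: power2_eq_square)
  qed
  have "?f (x', y') \<in> {-2..2} \<times> {-1..1}"
    if *: "x'\<^sup>2 + y'\<^sup>2 = n" "n dvd 2 * (x * y' - x' * y)" for x' y'
  proof -
    obtain q where q: "2 * (x * y' - x' * y) = n * q" using *(2) by blast
    have "(x * y' - x' * y)\<^sup>2 \<le> n\<^sup>2"
      using norm[OF *(1)] zero_le_power2[of "x * x' + y * y'"] by linarith
    then have "\<bar>x * y' - x' * y\<bar> \<le> n" using n by (simp add: abs_le_square_iff[symmetric])
    then have "n * q \<le> n * 2" "n * (-2) \<le> n * q" unfolding q[symmetric] by (simp_all add: abs_le_iff)
    then have "q \<le> 2" "-2 \<le> q" using n by (simp_all only: mult_le_cancel_left_pos)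
    moreover have "2 * (x * y' - x' * y) div n = q" using q n by simp
    ultimately show ?thesis by (simp add: sgn_if)
  qed
  then have sub: "?f ` ?S \<subseteq> {-2..2} \<times> {-1..1}"
    by (intro image_subsetI) (simp add: split_beta)
  have inj0: "a = c \<and> b = d"
    if 1: "a\<^sup>2 + b\<^sup>2 = n" "n dvd 2 * (x * b - a * y)"
      and 2: "c\<^sup>2 + d\<^sup>2 = n" "n dvd 2 * (x * d - c * y)"
      and eq: "2 * (x * b - a * y) div n = 2 * (x * d - c * y) div n"
      and sg: "sgn (x * a + y * b) = sgn (x * c + y * d)" for a b c d
  proof -
    have cr: "x * b - a * y = x * d - c * y"
      using dvd_div_eq_iff[OF 1(2) 2(2)] eq by simp
    have "(x * a + y * b)\<^sup>2 = (x * c + y * d)\<^sup>2"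
      using norm[OF 1(1)] norm[OF 2(1)] cr by simp
    then have "\<bar>x * a + y * b\<bar> = \<bar>x * c + y * d\<bar>" by (simp add: power2_eq_iff abs_eq_iff)
    moreover have "u = v" if "\<bar>u\<bar> = \<bar>v\<bar>" "sgn u = sgn v" for u v :: int
      using that by (auto simp: sgn_if abs_if split: if_splits)
    ultimately have dt: "x * a + y * b = x * c + y * d" using sg by blast
    \<comment> \<open>The map from \<open>(u, v)\<close> to its dot and cross products is linear
      with determinant \<open>n\<close>; these formulas invert it.\<close>
    have n1: "n * u = x * (x * u + y * v) - y * (x * v - u * y)"
      and n2: "n * v = y * (x * u + y * v) + x * (x * v - u * y)" for u v
      by (simp_all add: power2_eq_square algebra_simps flip: z)
    have "n * a = n * c" using n1[of a b] n1[of c d] unfolding cr dt by simp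
    moreover have "n * b = n * d" using n2[of b a] n2[of d c] unfolding cr dt by simp
    ultimately
    show "a = c \<and> b = d" using n by simp
  qed
  have inj: "inj_on ?f ?S"
  proof (rule inj_onI)
    fix u v assume "u \<in> ?S" "v \<in> ?S" "?f u = ?f v"
    then show "u = v"
      using inj0[of "fst u" "snd u" "fst v" "snd v"] by (simp add: prod_eq_iff split_beta)
  qed
  have "finite ?S" by (rule inj_on_finite[OF inj sub]) simp
  moreover have "card ?S \<le> card ({-2..2::int} \<times> {-1..1::int})"
    using inj sub by (intro card_inj_on_le) auto
  ultimately show ?thesis by (simp add: card_cartesian_product)
qed

section \<open>From fibres to the number of all representations\<close>

lemma finite_sum_squares_eq: "finite {(x::int, y::int). x\<^sup>2 + y\<^sup>2 = n}"
proof (rule finite_subset)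
  have le: "\<bar>a\<bar> \<le> a\<^sup>2" for a :: int
    using mult_left_mono[of 1 "\<bar>a\<bar>" "\<bar>a\<bar>"] by (cases "a = 0") (simp_all add: power2_eq_square)
  have "x \<in> {-n..n} \<and> y \<in> {-n..n}" if "x\<^sup>2 + y\<^sup>2 = n" for x y
    using le[of x] le[of y] zero_le_power2[of x] zero_le_power2[of y] that by auto
  then show "{(x, y). x\<^sup>2 + y\<^sup>2 = n} \<subseteq> {-n..n} \<times> {-n..n}" by blast
qed simp

text \<open>Send each representation to the divisor \<open>gcd (x * y0 - x0 * y) n\<close>. By
  \<open>same_gcd_imp_dvd_cross\<close> and \<open>card_dvd_cross_le\<close>, every fibre has at
  most \<open>15\<close> elements.\<close>

lemma card_coprime_sum_squares_le:
  fixes n :: nat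
  assumes n: "n > 0"
  shows "card {(x::int, y). x\<^sup>2 + y\<^sup>2 = int n \<and> coprime x y} \<le> 15 * card {d. d dvd n}"
proof -
  let ?S = "{(x::int, y). x\<^sup>2 + y\<^sup>2 = int n \<and> coprime x y}"
  have fin: "finite ?S"
    using finite_sum_squares_eq[of "int n"] by (rule finite_subset[rotated]) auto
  show ?thesis
  proof (cases "?S = {}")
    case False
    then obtain x0 y0 where z0: "x0\<^sup>2 + y0\<^sup>2 = int n" "coprime x0 y0" by blast
    define g where "g = (\<lambda>(x, y). nat (gcd (x * y0 - x0 * y) (int n)))"
    have gS: "g ` ?S \<subseteq> {d. d dvd n}"
      by (auto simp: g_def nat_dvd_iff)
    have fib: "card {z \<in> ?S. g z = d} \<le> 15" for d
    proof (cases "{z \<in> ?S. g z = d} = {}")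
      case False
      then obtain x y where z: "x\<^sup>2 + y\<^sup>2 = int n" "coprime x y" "g (x, y) = d" by blast
      have "int n dvd 2 * (x * y' - x' * y)" if "x'\<^sup>2 + y'\<^sup>2 = int n" "g (x', y') = d" for x' y'
      proof (rule same_gcd_imp_dvd_cross[OF z(1,2) that(1) z0])
        show "gcd (x * y0 - x0 * y) (int n) = gcd (x' * y0 - x0 * y') (int n)"
          using that(2) z(3) by (intro eq_nat_nat_iff[THEN iffD1]) (simp_all add: g_def)
      qed
      then have "{z \<in> ?S. g z = d} \<subseteq> {(x', y'). x'\<^sup>2 + y'\<^sup>2 = int n \<and> int n dvd 2 * (x * y' - x' * y)}"
        by auto
      then have "card {z \<in> ?S. g z = d} \<le> card {(x', y'). x'\<^sup>2 + y'\<^sup>2 = int n \<and> int n dvd 2 * (x * y' - x' * y)}"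
        using card_dvd_cross_le[of "int n" x y] n z by (intro card_mono) auto
      also have "\<dots> \<le> 15" using card_dvd_cross_le[of "int n" x y] n z by auto
      finally show ?thesis .
    qed (metis (no_types, lifting) card.empty zero_le)
    have "?S \<subseteq> (\<Union>d\<in>{d. d dvd n}. {z \<in> ?S. g z = d})"
    proof
      fix z assume z: "z \<in> ?S"
      then have "g z \<in> {d. d dvd n}" using gS by (rule subsetD[OF _ imageI, rotated])
      then show "z \<in> (\<Union>d\<in>{d. d dvd n}. {z \<in> ?S. g z = d})" using z by (intro UN_I[of "g z"]) simp_all
    qed
    then have "card ?S \<le> card (\<Union>d\<in>{d. d dvd n}. {z \<in> ?S. g z = d})"
      using n fin by (intro card_mono finite_UN_I) simp_all
    also have "\<dots> \<le> (\<Sum>d\<in>{d. d dvd n}. card {z \<in> ?S. g z = d})"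
      using n by (intro card_UN_le) simp
    also have "\<dots> \<le> (\<Sum>d\<in>{d. d dvd n}. 15)" using fib by (intro sum_mono)
    finally show ?thesis by simp
  qed (metis (no_types, lifting) card.empty zero_le)
qed

text \<open>Dividing \<open>(x, y)\<close> by its gcd \<open>g\<close> leaves a coprime
  representation of \<open>n div g\<^sup>2\<close>. Both the number of possible \<open>g\<close> and
  the divisor count of \<open>n div g\<^sup>2\<close> are at most the divisor count of
  \<open>n\<close>, hence the square.\<close>

lemma card_sum_squares_le:
  fixes n :: nat
  assumes n: "n > 0"
  shows "card {(x::int, y). x\<^sup>2 + y\<^sup>2 = int n} \<le> 15 * (card {d. d dvd n})\<^sup>2"
proof -
  let ?D = "{d. d dvd n}"
  let ?S = "\<lambda>m. {(x::int, y). x\<^sup>2 + y\<^sup>2 = int m \<and> coprime x y}"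
  let ?T = "\<lambda>g. (\<lambda>(x, y). (int g * x, int g * y)) ` ?S (n div g\<^sup>2)"
  have fin: "finite ?D" using n by simp
  have sub: "{(x::int, y). x\<^sup>2 + y\<^sup>2 = int n} \<subseteq> (\<Union>g\<in>{g\<in>?D. g\<^sup>2 dvd n}. ?T g)"
  proof clarify
    fix x y :: int assume *: "x\<^sup>2 + y\<^sup>2 = int n"
    then have "x \<noteq> 0 \<or> y \<noteq> 0" using n by auto
    then obtain a b where ab: "x = gcd x y * a" "y = gcd x y * b" "coprime a b"
      using gcd_coprime_exists[of x y] by (auto simp: mult.commute)
    define g where "g = nat (gcd x y)"
    have g: "x = int g * a" "y = int g * b" using ab by (simp_all add: g_def)
    have ng: "int n = int (g\<^sup>2) * (a\<^sup>2 + b\<^sup>2)" using * g by (simp add: algebra_simps power_mult_distrib)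
    then have g2: "g\<^sup>2 dvd n" by (metis dvd_triv_left int_dvd_int_iff)
    have g0: "g > 0" using ng n by (cases g) auto
    have "int (n div g\<^sup>2) = a\<^sup>2 + b\<^sup>2" using ng g0 by (simp add: zdiv_int)
    then have "(x, y) \<in> ?T g" using g ab(3) by (auto intro!: image_eqI[of _ _ "(a, b)"])
    moreover have "g dvd n" using g2 dvd_trans[of g "g\<^sup>2" n] by (simp add: dvd_power)
    ultimately show "(x, y) \<in> (\<Union>g\<in>{g\<in>?D. g\<^sup>2 dvd n}. ?T g)" using g2 by blast
  qed
  have finS: "finite (?S m)" for m
    using finite_sum_squares_eq[of "int m"] by (rule finite_subset[rotated]) auto
  have T: "card (?T g) \<le> 15 * card ?D" if "g\<^sup>2 dvd n" for g
  proof -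
    have pos: "n div g\<^sup>2 > 0" using that n by (metis dvd_div_eq_0_iff neq0_conv)
    have "card (?T g) \<le> card (?S (n div g\<^sup>2))" by (rule card_image_le[OF finS])
    also have "\<dots> \<le> 15 * card {d. d dvd n div g\<^sup>2}" by (rule card_coprime_sum_squares_le[OF pos])
    also have "n div g\<^sup>2 dvd n"
      using that by (intro dvdI[of _ _ "g\<^sup>2"]) simp
    then have "{d. d dvd n div g\<^sup>2} \<subseteq> ?D" by (auto intro: dvd_trans)
    then have "card {d. d dvd n div g\<^sup>2} \<le> card ?D" by (intro card_mono fin)
    finally show ?thesis by simp
  qed
  have "card {(x::int, y). x\<^sup>2 + y\<^sup>2 = int n} \<le> card (\<Union>g\<in>{g\<in>?D. g\<^sup>2 dvd n}. ?T g)"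
    using sub fin finS by (intro card_mono) auto
  also have "\<dots> \<le> (\<Sum>g\<in>{g\<in>?D. g\<^sup>2 dvd n}. card (?T g))"
    using fin by (intro card_UN_le) auto
  also have "\<dots> \<le> (\<Sum>g\<in>{g\<in>?D. g\<^sup>2 dvd n}. 15 * card ?D)" using T by (intro sum_mono) auto
  also have "\<dots> \<le> card ?D * (15 * card ?D)"
    using card_mono[OF fin, of "{g\<in>?D. g\<^sup>2 dvd n}"] by (simp add: subset_iff)
  finally show ?thesis by (simp add: power2_eq_square)
qed

subsection \<open>Lattice points on a circle with given diameter\<close>

lemma sqlen_nonneg [simp]: "0 \<le> sqlen k"
  by (simp add: sqlen_def)

lemma sqlen_eq_0_iff [simp]: "sqlen k = 0 \<longleftrightarrow> k = 0"
  by (simp add: sqlen_def sum_power2_eq_zero_iff prod_eq_iff)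

lemma sqlen_0 [simp]: "sqlen 0 = 0"
  by simp

lemma sqlen_pos_iff [simp]: "0 < sqlen k \<longleftrightarrow> k \<noteq> 0"
  using sqlen_nonneg[of k] sqlen_eq_0_iff[of k] by linarith

lemma sqlen_minus_commute: "sqlen (k - l) = sqlen (l - k)"
  by (simp add: sqlen_def power2_commute)

text \<open>By the parallelogram law the gap is \<open>sqlen (k + l)\<close>.\<close>

lemma sqlen_diff_le: "sqlen (k - l) \<le> 2 * (sqlen k + sqlen l)"
proof -
  have "2 * (sqlen k + sqlen l) - sqlen (k - l) = sqlen (k + l)"
    by (simp add: sqlen_def power2_eq_square algebra_simps)
  then show ?thesis using sqlen_nonneg[of "k + l"] by linarith
qed

text \<open>By Thales, these are the positions of a vertex of a rectangle relative to a second vertex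
  from which the diagonal \<open>v\<close> starts.\<close>

definition thales :: "Z2 \<Rightarrow> Z2 set" where
  "thales v = {k. sqlen k + sqlen (v - k) = sqlen v}"

text \<open>For \<open>k\<close> in \<open>thales v\<close>, this is the squared shorter side of the
  rectangle with vertices \<open>0\<close>, \<open>k\<close>, \<open>v\<close>,
  \<open>v - k\<close>.\<close>

definition side_sq :: "Z2 \<Rightarrow> Z2 \<Rightarrow> int" where
  "side_sq v k = min (sqlen k) (sqlen (v - k))"

lemma side_sq_nonneg [simp]: "0 \<le> side_sq v k"
  by (simp add: side_sq_def)

lemma thales_0: "thales 0 = {0}"
proof -
  have "k \<in> thales 0 \<longleftrightarrow> k = 0" for k
    using sqlen_minus_commute[of 0 k] by (auto simp: thales_def)
  then show ?thesis by blast
qed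

lemma thales_iff: "k \<in> thales v \<longleftrightarrow> sqlen k = fst k * fst v + snd k * snd v"
  by (auto simp: thales_def sqlen_def power2_eq_square algebra_simps)

lemma thales_reflect: "v - k \<in> thales v \<longleftrightarrow> k \<in> thales v"
  by (auto simp: thales_def)

text \<open>Sending \<open>k\<close> to \<open>2 k - v\<close> clears the possibly half-integral
  centre \<open>v / 2\<close> and lands on the circle of squared radius \<open>sqlen v\<close> about
  the origin.\<close>

lemma card_thales_le:
  assumes "v \<noteq> 0"
  shows "finite (thales v) \<and> card (thales v) \<le> 15 * (card {d. d dvd nat (sqlen v)})\<^sup>2"
proof -
  let ?f = "\<lambda>k::Z2. (2 * fst k - fst v, 2 * snd k - snd v)"
  have inj: "inj_on ?f (thales v)" by (auto simp: inj_on_def prod_eq_iff)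
  have pos: "nat (sqlen v) > 0" using assms by simp
  have "(2 * fst k - fst v)\<^sup>2 + (2 * snd k - snd v)\<^sup>2 = sqlen v" if "k \<in> thales v" for k
    using that by (simp add: thales_iff) (simp add: sqlen_def power2_eq_square algebra_simps)
  then have sub: "?f ` thales v \<subseteq> {(x, y). x\<^sup>2 + y\<^sup>2 = int (nat (sqlen v))}" by auto
  have "finite (thales v)" by (rule inj_on_finite[OF inj sub finite_sum_squares_eq])
  moreover have "card (thales v) \<le> card {(x::int, y). x\<^sup>2 + y\<^sup>2 = int (nat (sqlen v))}"
    by (rule card_inj_on_le[OF inj sub finite_sum_squares_eq])
  ultimately show ?thesis using card_sum_squares_le[OF pos] by linarith
qed

lemma finite_thales [simp]: "finite (thales v)"
  using card_thales_le[of v] by (cases "v = 0") (simp_all add: thales_0)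

lemma card_thales_bound:
  fixes \<epsilon> :: real
  assumes "\<epsilon> > 0"
  shows "\<exists>C\<ge>0. \<forall>v. v \<noteq> 0 \<longrightarrow> real (card (thales v)) \<le> C * of_int (sqlen v) powr \<epsilon>"
proof -
  \<comment> \<open>The count involves the square of the divisor function, so each factor gets half
    of the exponent.\<close>
  obtain C where C: "\<And>n. n > 0 \<Longrightarrow> real (card {d. d dvd n}) \<le> C * real n powr (\<epsilon> / 2)"
    using divisor_bound[of "\<epsilon> / 2"] assms by auto
  have "real (card (thales v)) \<le> 15 * C\<^sup>2 * of_int (sqlen v) powr \<epsilon>" if "v \<noteq> 0" for v
  proof -
    let ?n = "nat (sqlen v)"
    have pos: "?n > 0" using that by simp
    have "real (card (thales v)) \<le> 15 * (real (card {d. d dvd ?n}))\<^sup>2"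
      using of_nat_mono[OF conjunct2[OF card_thales_le[OF that]], where 'a = real] by simp
    also have "(real (card {d. d dvd ?n}))\<^sup>2 \<le> (C * real ?n powr (\<epsilon> / 2))\<^sup>2"
      using C[OF pos] by (intro power_mono) auto
    also have "\<dots> = C\<^sup>2 * of_int (sqlen v) powr \<epsilon>"
      using pos by (simp add: power_mult_distrib power2_eq_square[of "_ powr _"] flip: powr_add)
    finally show ?thesis by simp
  qed
  then show ?thesis by (intro exI[of _ "15 * C\<^sup>2"]) simp
qed

text \<open>Two distinct nonzero points of a circle through the origin determine its diameter \<open>v\<close> by
  Cramer's rule, and the determinant is a nonzero integer.\<close>

lemma sqlen_le_of_two_points:
  assumes k: "k \<in> thales v" "k \<noteq> 0" and l: "l \<in> thales v" "l \<noteq> 0" and ne: "k \<noteq> l"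
  shows "sqlen v \<le> sqlen k * sqlen l * sqlen (k - l)"
proof -
  obtain a b c d p q where eqs: "k = (a, b)" "l = (c, d)" "v = (p, q)" by (metis surj_pair)
  define m where "m = a\<^sup>2 + b\<^sup>2"
  define m' where "m' = c\<^sup>2 + d\<^sup>2"
  define X where "X = a * d - b * c"
  have m: "m = a * p + b * q" and m': "m' = c * p + d * q"
    using k(1) l(1) by (simp_all add: thales_iff eqs sqlen_def m_def m'_def)
  have m0: "m \<noteq> 0" "m' \<noteq> 0" using k(2) l(2)
    by (simp_all add: m_def m'_def eqs sum_power2_eq_zero_iff zero_prod_def)
  have "p * X = d * m - b * m'" "q * X = a * m' - c * m"
    unfolding m m' X_def by (simp_all add: algebra_simps)
  then have "(p\<^sup>2 + q\<^sup>2) * X\<^sup>2 = (d * m - b * m')\<^sup>2 + (a * m' - c * m)\<^sup>2"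
    by (metis (no_types) distrib_right power_mult_distrib)
  also have "\<dots> = (c\<^sup>2 + d\<^sup>2) * m\<^sup>2 + (a\<^sup>2 + b\<^sup>2) * m'\<^sup>2 - 2 * m * m' * (a * c + b * d)"
    by (simp add: power2_eq_square algebra_simps)
  \<comment> \<open>As \<open>m\<close> and \<open>m'\<close> are also the squared lengths of
    \<open>k\<close> and \<open>l\<close>, the factor \<open>m * m'\<close> comes out and leaves
    \<open>m + m' - 2 * (a * c + b * d)\<close>, the squared length of \<open>k - l\<close>.\<close>
  also have "\<dots> = m * m' * ((a - c)\<^sup>2 + (b - d)\<^sup>2)"
    unfolding m_def[symmetric] m'_def[symmetric]
    by (simp add: m_def m'_def power2_eq_square algebra_simps)
  finally have id: "sqlen v * X\<^sup>2 = sqlen k * sqlen l * sqlen (k - l)"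
    by (simp add: eqs sqlen_def m_def m'_def)
  have "X \<noteq> 0"
  proof
    assume "X = 0"
    then have "sqlen k * sqlen l * sqlen (k - l) = 0" using id by simp
    then show False using k(2) l(2) ne by simp
  qed
  then have "1 \<le> X\<^sup>2" by (simp add: int_one_le_iff_zero_less)
  then have "sqlen v * 1 \<le> sqlen v * X\<^sup>2" by (intro mult_left_mono) simp_all
  then show ?thesis using id by simp
qed

text \<open>Besides the origin at most one point is this close: for two of them, with
  \<open>m\<close> the larger squared length, \<open>sqlen_le_of_two_points\<close> would give
  \<open>sqlen v \<le> m * m * (4 * m) < sqlen v\<close>.\<close>

lemma card_thales_near_le: "card {k \<in> thales v. 4 * (sqlen k) ^ 3 < sqlen v} \<le> 2"
proof -
  let ?N = "{k \<in> thales v. 4 * (sqlen k) ^ 3 < sqlen v}"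
  have "k = l" if "k \<in> ?N - {0}" "l \<in> ?N - {0}" for k l
  proof (rule ccontr)
    assume ne: "k \<noteq> l"
    let ?m = "max (sqlen k) (sqlen l)"
    have "sqlen v \<le> sqlen k * sqlen l * sqlen (k - l)"
      using that ne by (intro sqlen_le_of_two_points) auto
    also have "\<dots> \<le> ?m * ?m * (4 * ?m)"
      using sqlen_diff_le[of k l] by (intro mult_mono) (auto simp: le_max_iff_disj)
    also have "\<dots> = 4 * ?m ^ 3" by (simp add: power3_eq_cube)
    also have "\<dots> < sqlen v" using that by (simp add: max_def)
    finally show False by simp
  qed
  moreover have "finite ?N" by simp
  ultimately have "card (?N - {0}) \<le> Suc 0" by (intro card_le_Suc0_iff_eq[THEN iffD2]) auto
  then show ?thesis by (simp add: card_Diff_singleton_if split: if_splits)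
qed

text \<open>A circle carries boundedly many lattice points close to either end of a given diameter,
  and the divisor bound is paid only by points at distance at least the cube root of the diameter.\<close>

lemma sum_thales_bound:
  fixes \<gamma> :: real
  assumes \<gamma>: "\<gamma> > 0"
  shows "\<exists>C\<ge>0. \<forall>v. (\<Sum>k\<in>thales v. (1 + of_int (side_sq v k)) powr -\<gamma>) \<le> C"
proof -
  \<comment> \<open>The exponent \<open>\<gamma> / 3\<close> is chosen so that the number of far
    points cancels their weight, at most \<open>(sqlen v / 4) powr (-\<gamma> / 3)\<close>.\<close>
  obtain C where C0: "C \<ge> 0"
    and C: "\<And>v. v \<noteq> 0 \<Longrightarrow> real (card (thales v)) \<le> C * of_int (sqlen v) powr (\<gamma> / 3)"
    using card_thales_bound[of "\<gamma> / 3"] \<gamma> by auto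
  let ?w = "\<lambda>v k. (1 + of_int (side_sq v k)) powr -\<gamma> :: real"
  have w1: "?w v k \<le> 1" for v k
    using powr_mono2'[of "-\<gamma>" 1 "1 + of_int (side_sq v k)"] \<gamma> by simp
  have "(\<Sum>k\<in>thales v. ?w v k) \<le> 4 + C * 4 powr (\<gamma> / 3)" if v: "v \<noteq> 0" for v
  proof -
    let ?n = "sqlen v"
    let ?N = "{k \<in> thales v. 4 * (sqlen k) ^ 3 < ?n}"
    let ?N' = "{k \<in> thales v. 4 * (sqlen (v - k)) ^ 3 < ?n}"
    let ?F = "thales v - (?N \<union> ?N')"
    have n: "0 < ?n" using v by simp
    \<comment> \<open>Reflection exchanges the two ends of the diameter, so each end has at most two
      near points.\<close>
    have "?N' \<subseteq> (\<lambda>k. v - k) ` ?N"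
    proof
      fix k assume "k \<in> ?N'"
      then show "k \<in> (\<lambda>k. v - k) ` ?N"
        by (intro image_eqI[of _ _ "v - k"]) (simp_all add: thales_reflect)
    qed
    then have "card ?N' \<le> card ?N" by (intro surj_card_le) simp_all
    then have "card (?N \<union> ?N') \<le> 4"
      using card_Un_le[of ?N ?N'] card_thales_near_le[of v] by linarith
    then have near: "(\<Sum>k\<in>?N \<union> ?N'. ?w v k) \<le> 4"
      using sum_mono[of "?N \<union> ?N'" "?w v" "\<lambda>_. 1"] w1 by simp
    have wF: "?w v k \<le> (?n / 4) powr (-\<gamma> / 3)" if "k \<in> ?F" for k
    proof -
      let ?s = "side_sq v k"
      have "?n \<le> 4 * ?s ^ 3" using that by (auto simp: side_sq_def min_def)
      then have "real_of_int ?n \<le> of_int (4 * ?s ^ 3)" by (simp only: of_int_le_iff)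
      then have "?n / 4 \<le> real_of_int ?s ^ 3" by simp
      also have "\<dots> \<le> (1 + of_int ?s) ^ 3" by (intro power_mono) auto
      finally have "((1 + real_of_int ?s) ^ 3) powr (-\<gamma> / 3) \<le> (?n / 4) powr (-\<gamma> / 3)"
        using n \<gamma> by (intro powr_mono2') auto
      also have "((1 + real_of_int ?s) ^ 3) powr (-\<gamma> / 3) = ?w v k"
        using side_sq_nonneg[of v k] by (simp add: powr_powr flip: powr_numeral)
      finally show ?thesis .
    qed
    have "(\<Sum>k\<in>?F. ?w v k) \<le> real (card ?F) * (?n / 4) powr (-\<gamma> / 3)"
      using sum_mono[of ?F "?w v" "\<lambda>_. (?n / 4) powr (-\<gamma> / 3)", OF wF] by simp
    also have "\<dots> \<le> (C * of_int ?n powr (\<gamma> / 3)) * (?n / 4) powr (-\<gamma> / 3)"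
    proof (rule mult_right_mono)
      have "card ?F \<le> card (thales v)" by (intro card_mono) auto
      then show "real (card ?F) \<le> C * of_int ?n powr (\<gamma> / 3)" using C[OF v] by linarith
    qed simp
    also have "\<dots> = C * 4 powr (\<gamma> / 3)"
      using n by (simp add: powr_divide powr_minus field_simps)
    finally have far: "(\<Sum>k\<in>?F. ?w v k) \<le> C * 4 powr (\<gamma> / 3)" .
    have "(\<Sum>k\<in>thales v. ?w v k) = (\<Sum>k\<in>?F. ?w v k) + (\<Sum>k\<in>?N \<union> ?N'. ?w v k)"
      by (intro sum.subset_diff) auto
    then show ?thesis using near far by linarith
  qed
  moreover have C4: "0 \<le> C * 4 powr (\<gamma> / 3)" using C0 by simp
  \<comment> \<open>The degenerate circle is the single point \<open>0\<close>, whose weight is at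
    most \<open>1\<close>.\<close>
  then have "(\<Sum>k\<in>thales 0. ?w 0 k) \<le> 4 + C * 4 powr (\<gamma> / 3)"
    using w1[of 0 0] by (subst thales_0) (simp del: sum.insert, simp)
  ultimately have "(\<Sum>k\<in>thales v. ?w v k) \<le> 4 + C * 4 powr (\<gamma> / 3)" for v
    by (cases "v = 0") simp_all
  then show ?thesis using C4 by (intro exI[of _ "4 + C * 4 powr (\<gamma> / 3)"]) simp
qed

subsection \<open>A trilinear estimate over rectangles\<close>

text \<open>The minimum is the square of the shorter side of the rectangle \<open>j2, j1, j, j3\<close>.  It is read off from either
  diagonal, which is what lets the same weight serve both factors of the Cauchy--Schwarz
  inequality.\<close>

definition side_weight :: "real \<Rightarrow> Z2 \<times> Z2 \<times> Z2 \<Rightarrow> real" where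
  "side_weight \<gamma> = (\<lambda>(j1, j2, j3). (1 + of_int (min (sqlen (j1 - j2)) (sqlen (j3 - j2)))) powr -\<gamma>)"

lemma side_weight_nonneg [simp]: "0 \<le> side_weight \<gamma> t"
  by (simp add: side_weight_def split: prod.split)

text \<open>After elimination of \<open>j3\<close>, the resonance defect is twice the defect in the
  right-angle condition at \<open>j1\<close>. In this form \<open>R j\<close> is enumerated by
  \<open>j2\<close> and a point on the circle with diameter \<open>j - j2\<close>.\<close>

lemma R_iff: "(j1, j2, j3) \<in> R j \<longleftrightarrow> j3 = j - j1 + j2 \<and> j1 - j2 \<in> thales (j - j2)"
proof -
  have eq_iff: "a = b \<longleftrightarrow> c = d" if "a - b = 2 * (c - d)" for a b c d :: int
    using that by auto
  have "sqlen j1 - sqlen j2 + sqlen (j - j1 + j2) - sqlen j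
      = 2 * (sqlen (j1 - j2) - (fst (j1 - j2) * fst (j - j2) + snd (j1 - j2) * snd (j - j2)))"
    by (simp add: sqlen_def power2_eq_square algebra_simps)
  then have "sqlen j1 - sqlen j2 + sqlen (j - j1 + j2) = sqlen j \<longleftrightarrow> j1 - j2 \<in> thales (j - j2)"
    unfolding thales_iff by (rule eq_iff)
  moreover have "j1 - j2 + j3 = j \<longleftrightarrow> j3 = j - j1 + j2" by (auto simp: algebra_simps)
  moreover have "(j1, j2, j3) \<in> R j \<longleftrightarrow> j1 - j2 + j3 = j \<and> sqlen j1 - sqlen j2 + sqlen j3 = sqlen j"
    by (simp add: R_def)
  ultimately show ?thesis by metis
qed

text \<open>The same rectangle read from its other diagonal: with \<open>j1\<close> and
  \<open>j3\<close> fixed, \<open>j2\<close> runs over a circle and determines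
  \<open>j\<close>.\<close>

lemma R_iff': "(j1, j2, j3) \<in> R j \<longleftrightarrow> j = j1 - j2 + j3 \<and> j2 - j1 \<in> thales (j3 - j1)"
proof -
  have eq_iff: "a = b \<longleftrightarrow> c = d" if "a - b = - 2 * (c - d)" for a b c d :: int
    using that by auto
  have "sqlen j1 - sqlen j2 + sqlen j3 - sqlen (j1 - j2 + j3)
      = - 2 * (sqlen (j2 - j1) - (fst (j2 - j1) * fst (j3 - j1) + snd (j2 - j1) * snd (j3 - j1)))"
    by (simp add: sqlen_def power2_eq_square algebra_simps)
  then have "sqlen j1 - sqlen j2 + sqlen j3 = sqlen (j1 - j2 + j3) \<longleftrightarrow> j2 - j1 \<in> thales (j3 - j1)"
    unfolding thales_iff by (rule eq_iff)
  then show ?thesis unfolding R_def by blast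
qed

lemma side_weight_R:
  assumes "(j1, j2, j3) \<in> R j"
  shows "side_weight \<gamma> (j1, j2, j3) = (1 + of_int (side_sq (j - j2) (j1 - j2))) powr -\<gamma>"
proof -
  have "j - j2 - (j1 - j2) = j3 - j2" using assms by (simp add: R_iff)
  then show ?thesis by (simp add: side_weight_def side_sq_def)
qed

lemma side_weight_eq:
  "side_weight \<gamma> (j1, j2, j3) = (1 + of_int (side_sq (j3 - j1) (j2 - j1))) powr -\<gamma>"
  by (simp add: side_weight_def side_sq_def sqlen_minus_commute[of j2 j1])

text \<open>For fixed \<open>j\<close>, the triples with a given \<open>j2\<close> have weights
  adding up to at most the circle sum for diameter \<open>j - j2\<close>, hence to at most
  \<open>C\<close>. Finite sets \<open>B\<close> are used because convergence is to be derived from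
  this bound.\<close>

lemma sum_R_weight_le:
  fixes y :: "Z2 \<Rightarrow> real"
  assumes C: "\<And>v. (\<Sum>k\<in>thales v. (1 + of_int (side_sq v k)) powr -\<gamma>) \<le> C"
    and y: "\<And>q. 0 \<le> y q" "y summable_on UNIV" and B: "finite B" "B \<subseteq> R j"
  shows "(\<Sum>(j1, j2, j3)\<in>B. side_weight \<gamma> (j1, j2, j3) * y j2) \<le> C * infsum y UNIV"
proof -
  define P where "P = (\<lambda>(j1, j2, j3). j2) ` B"
  have P: "finite P" using B(1) by (simp add: P_def)
  have C0: "0 \<le> C" using C[of 0] by (rule order_trans[rotated]) (simp add: sum_nonneg)
  have "(\<Sum>(j1, j2, j3)\<in>B. side_weight \<gamma> (j1, j2, j3) * y j2)
      \<le> (\<Sum>(q, k)\<in>Sigma P (\<lambda>q. thales (j - q)). (1 + of_int (side_sq (j - q) k)) powr -\<gamma> * y q)"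
  proof (rule sum_le_included[where i = "\<lambda>(q, k). (k + q, q, j - k)"])
    show "\<forall>t\<in>B. \<exists>u\<in>Sigma P (\<lambda>q. thales (j - q)). (case u of (q, k) \<Rightarrow> (k + q, q, j - k)) = t \<and>
        (case t of (j1, j2, j3) \<Rightarrow> side_weight \<gamma> (j1, j2, j3) * y j2)
        \<le> (case u of (q, k) \<Rightarrow> (1 + of_int (side_sq (j - q) k)) powr -\<gamma> * y q)"
    proof
      fix t assume t: "t \<in> B"
      obtain j1 j2 j3 where eq: "t = (j1, j2, j3)" by (metis surj_pair)
      have R: "(j1, j2, j3) \<in> R j" using t B(2) eq by blast
      have "j2 \<in> P" using t eq by (force simp: P_def)
      then show "\<exists>u\<in>Sigma P (\<lambda>q. thales (j - q)). (case u of (q, k) \<Rightarrow> (k + q, q, j - k)) = t \<and>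
        (case t of (j1, j2, j3) \<Rightarrow> side_weight \<gamma> (j1, j2, j3) * y j2)
        \<le> (case u of (q, k) \<Rightarrow> (1 + of_int (side_sq (j - q) k)) powr -\<gamma> * y q)"
        using R[unfolded R_iff] side_weight_R[OF R, of \<gamma>]
        by (intro bexI[of _ "(j2, j1 - j2)"]) (simp_all add: eq)
    qed
  qed (use P B y in \<open>auto intro!: mult_nonneg_nonneg\<close>)
  also have "\<dots> = (\<Sum>q\<in>P. (\<Sum>k\<in>thales (j - q). (1 + of_int (side_sq (j - q) k)) powr -\<gamma>) * y q)"
    using P by (simp add: sum.Sigma[symmetric] sum_distrib_right)
  also have "\<dots> \<le> (\<Sum>q\<in>P. C * y q)" using C y by (intro sum_mono mult_right_mono) auto
  also have "\<dots> = C * sum y P" by (simp add: sum_distrib_left)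
  also have "\<dots> \<le> C * infsum y UNIV"
    using P y C0 by (intro mult_left_mono finite_sum_le_infsum) auto
  finally show ?thesis .
qed

text \<open>Here \<open>j\<close> is summed as well. With \<open>j1\<close> and \<open>j3\<close>
  fixed, the sum over \<open>j2\<close> costs \<open>C\<close>, and the rest factors into sums over
  \<open>j1\<close> and over \<open>j3\<close>.\<close>

lemma sum_Sigma_R_weight_le:
  fixes x z :: "Z2 \<Rightarrow> real"
  assumes C: "\<And>v. (\<Sum>k\<in>thales v. (1 + of_int (side_sq v k)) powr -\<gamma>) \<le> C"
    and x: "\<And>q. 0 \<le> x q" "x summable_on UNIV" and z: "\<And>q. 0 \<le> z q" "z summable_on UNIV"
    and B: "finite B" "B \<subseteq> Sigma UNIV R"
  shows "(\<Sum>(j, j1, j2, j3)\<in>B. side_weight \<gamma> (j1, j2, j3) * (x j1 * z j3))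
    \<le> C * (infsum x UNIV * infsum z UNIV)"
proof -
  define P where "P = (\<lambda>(j, j1, j2, j3). j1) ` B"
  define Q where "Q = (\<lambda>(j, j1, j2, j3). j3) ` B"
  have P: "finite P" "finite Q" using B(1) by (simp_all add: P_def Q_def)
  have C0: "0 \<le> C" using C[of 0] by (rule order_trans[rotated]) (simp add: sum_nonneg)
  let ?D = "Sigma (P \<times> Q) (\<lambda>r. thales (snd r - fst r))"
  let ?g = "\<lambda>(r, k). (1 + of_int (side_sq (snd r - fst r) k)) powr -\<gamma> * (x (fst r) * z (snd r))"
  let ?i = "\<lambda>((p, q), k). (q - k, p, p + k, q)"
  have "(\<Sum>(j, j1, j2, j3)\<in>B. side_weight \<gamma> (j1, j2, j3) * (x j1 * z j3)) \<le> sum ?g ?D"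
  proof (rule sum_le_included[where i = ?i])
    show "\<forall>t\<in>B. \<exists>u\<in>?D. ?i u = t \<and>
        (case t of (j, j1, j2, j3) \<Rightarrow> side_weight \<gamma> (j1, j2, j3) * (x j1 * z j3)) \<le> ?g u"
    proof
      fix t assume t: "t \<in> B"
      obtain j j1 j2 j3 where eq: "t = (j, j1, j2, j3)" by (metis surj_pair)
      have R: "(j1, j2, j3) \<in> R j" using t B(2) eq by blast
      have "j1 \<in> P" "j3 \<in> Q" using t eq by (force simp: P_def Q_def)+
      then show "\<exists>u\<in>?D. ?i u = t \<and>
        (case t of (j, j1, j2, j3) \<Rightarrow> side_weight \<gamma> (j1, j2, j3) * (x j1 * z j3)) \<le> ?g u"
        using R by (intro bexI[of _ "((j1, j3), j2 - j1)"]) (simp_all add: eq side_weight_eq R_iff')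
    qed
  qed (use P B x z in \<open>auto intro!: mult_nonneg_nonneg\<close>)
  also have "\<dots> = (\<Sum>r\<in>P \<times> Q.
      (\<Sum>k\<in>thales (snd r - fst r). (1 + of_int (side_sq (snd r - fst r) k)) powr -\<gamma>) * (x (fst r) * z (snd r)))"
    using P by (simp add: sum.Sigma[symmetric] sum_distrib_right)
  also have "\<dots> \<le> (\<Sum>r\<in>P \<times> Q. C * (x (fst r) * z (snd r)))"
    using C x z by (intro sum_mono mult_right_mono) auto
  also have "\<dots> = C * (sum x P * sum z Q)"
  proof -
    have "(\<Sum>r\<in>P \<times> Q. x (fst r) * z (snd r)) = sum x P * sum z Q"
      by (simp add: sum_product sum.cartesian_product split_beta)
    then show ?thesis by (simp flip: sum_distrib_left)
  qed
  also have "\<dots> \<le> C * (infsum x UNIV * infsum z UNIV)"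
    using P x z C0 by (intro mult_left_mono mult_mono finite_sum_le_infsum infsum_nonneg sum_nonneg) auto
  finally show ?thesis .
qed

definition trilinear_term ::
    "real \<Rightarrow> (Z2 \<Rightarrow> real) \<Rightarrow> (Z2 \<Rightarrow> real) \<Rightarrow> (Z2 \<Rightarrow> real) \<Rightarrow> Z2 \<times> Z2 \<times> Z2 \<Rightarrow> real" where
  "trilinear_term \<gamma> x y z = (\<lambda>(j1, j2, j3). side_weight \<gamma> (j1, j2, j3) * (x j1 * y j2 * z j3))"

text \<open>Cauchy--Schwarz over \<open>R j\<close> splits the weight into two square roots, giving
  \<open>y\<close> to one factor and \<open>x\<close>, \<open>z\<close> to the other. The first
  factor costs \<open>C\<close> uniformly in \<open>j\<close>; the second, the sum of
  \<open>G\<close>, costs another \<open>C\<close> once it is summed over \<open>j\<close>.\<close>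

lemma trilinear_bound:
  fixes x y z :: "Z2 \<Rightarrow> real"
  assumes C: "\<And>v. (\<Sum>k\<in>thales v. (1 + of_int (side_sq v k)) powr -\<gamma>) \<le> C"
    and nonneg: "\<And>q. 0 \<le> x q" "\<And>q. 0 \<le> y q" "\<And>q. 0 \<le> z q"
    and x: "(\<lambda>q. (x q)\<^sup>2) summable_on UNIV"
    and y: "(\<lambda>q. (y q)\<^sup>2) summable_on UNIV"
    and z: "(\<lambda>q. (z q)\<^sup>2) summable_on UNIV"
  shows "trilinear_term \<gamma> x y z summable_on R j" (is "?T summable_on _")
    and "(\<lambda>j. (\<Sum>\<^sub>\<infinity>t\<in>R j. trilinear_term \<gamma> x y z t)\<^sup>2) summable_on UNIV"
    and "(\<Sum>\<^sub>\<infinity>j. (\<Sum>\<^sub>\<infinity>t\<in>R j. trilinear_term \<gamma> x y z t)\<^sup>2)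
      \<le> C\<^sup>2 * ((\<Sum>\<^sub>\<infinity>q. (x q)\<^sup>2) * (\<Sum>\<^sub>\<infinity>q. (y q)\<^sup>2) * (\<Sum>\<^sub>\<infinity>q. (z q)\<^sup>2))"
proof -
  define G where "G = (\<lambda>(j1, j2 :: Z2, j3). side_weight \<gamma> (j1, j2, j3) * ((x j1)\<^sup>2 * (z j3)\<^sup>2))"
  let ?X = "\<Sum>\<^sub>\<infinity>q. (x q)\<^sup>2" and ?Y = "\<Sum>\<^sub>\<infinity>q. (y q)\<^sup>2" and ?Z = "\<Sum>\<^sub>\<infinity>q. (z q)\<^sup>2"
  have C0: "0 \<le> C" using C[of 0] by (rule order_trans[rotated]) (simp add: sum_nonneg)
  have Y0: "0 \<le> ?Y" by (intro infsum_nonneg) simp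
  have G0: "0 \<le> G t" for t by (simp add: G_def split: prod.split)
  have T0: "0 \<le> ?T t" for t using nonneg by (simp add: trilinear_term_def split: prod.split)
  have fin: "(\<Sum>(j, t)\<in>B. G t) \<le> C * (?X * ?Z)" if "finite B" "B \<subseteq> Sigma UNIV R" for B
    using sum_Sigma_R_weight_le[OF C _ x _ z that] by (simp add: G_def split_beta)
  \<comment> \<open>Summability over all pairs \<open>(j, t)\<close> at once yields both convergence
    on each \<open>R j\<close> and convergence of the outer sum over \<open>j\<close>.\<close>
  have sumG: "(\<lambda>(j, t). G t) summable_on Sigma UNIV R"
  proof (rule nonneg_bdd_above_summable_on)
    show "bdd_above (sum (\<lambda>(j, t). G t) ` {F. F \<subseteq> Sigma UNIV R \<and> finite F})"
      using fin by (intro bdd_aboveI2[where M = "C * (?X * ?Z)"]) blast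
  qed (auto simp: G0)
  then have GR: "G summable_on R j" for j by (rule summable_on_SigmaD1) simp
  have sumG': "(\<lambda>j. infsum G (R j)) summable_on UNIV"
    using summable_on_Sigma_banach[OF sumG] by simp
  have "(\<Sum>\<^sub>\<infinity>j. infsum G (R j)) = infsum (\<lambda>(j, t). G t) (Sigma UNIV R)"
    using infsum_Sigma'_banach[OF sumG] by simp
  also have "\<dots> \<le> C * (?X * ?Z)" using sumG fin by (intro infsum_le_finite_sums) auto
  finally have totG: "(\<Sum>\<^sub>\<infinity>j. infsum G (R j)) \<le> C * (?X * ?Z)" .
  have finT: "sum ?T B \<le> sqrt (C * ?Y * infsum G (R j))" if B: "finite B" "B \<subseteq> R j" for B j
  proof (rule real_le_rsqrt)
    let ?u = "\<lambda>(j1, j2, j3). sqrt (side_weight \<gamma> (j1, j2, j3)) * y j2"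
    let ?v = "\<lambda>(j1, j2, j3). sqrt (side_weight \<gamma> (j1, j2, j3)) * (x j1 * z j3)"
    have "?u t * ?v t = ?T t" for t
    proof -
      have "sqrt w * b * (sqrt w * (a * c)) = w * (a * b * c)" if "0 \<le> w" for w a b c :: real
        using real_sqrt_mult_self[of w] that by (simp add: mult_ac)
      then show ?thesis by (simp add: trilinear_term_def split: prod.split)
    qed
    then have "(sum ?T B)\<^sup>2 \<le> (\<Sum>t\<in>B. (?u t)\<^sup>2) * (\<Sum>t\<in>B. (?v t)\<^sup>2)"
      using Cauchy_Schwarz_ineq_sum[of ?u ?v B] by simp
    also have "(\<Sum>t\<in>B. (?u t)\<^sup>2) = (\<Sum>(j1, j2, j3)\<in>B. side_weight \<gamma> (j1, j2, j3) * (y j2)\<^sup>2)"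
      by (intro sum.cong) (auto simp: power_mult_distrib)
    also have "(\<Sum>t\<in>B. (?v t)\<^sup>2) = sum G B"
      by (intro sum.cong) (auto simp: power_mult_distrib G_def)
    also have "(\<Sum>(j1, j2, j3)\<in>B. side_weight \<gamma> (j1, j2, j3) * (y j2)\<^sup>2) * sum G B
        \<le> (C * ?Y) * infsum G (R j)"
      using sum_R_weight_le[OF C _ y B] GR[of j] B G0 C0 Y0
      by (intro mult_mono finite_sum_le_infsum) (auto intro: sum_nonneg)
    finally show "(sum ?T B)\<^sup>2 \<le> C * ?Y * infsum G (R j)" .
  qed
  have sumT: "?T summable_on R j" for j
  proof (rule nonneg_bdd_above_summable_on)
    show "bdd_above (sum ?T ` {F. F \<subseteq> R j \<and> finite F})"
      using finT by (intro bdd_aboveI2[where M = "sqrt (C * ?Y * infsum G (R j))"]) blast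
  qed (rule T0)
  then show "?T summable_on R j" .
  have sq: "(infsum ?T (R j))\<^sup>2 \<le> C * ?Y * infsum G (R j)" for j
  proof -
    have "infsum ?T (R j) \<le> sqrt (C * ?Y * infsum G (R j))"
      using sumT finT by (intro infsum_le_finite_sums) auto
    then have "(infsum ?T (R j))\<^sup>2 \<le> (sqrt (C * ?Y * infsum G (R j)))\<^sup>2"
      using T0 by (intro power_mono infsum_nonneg) auto
    also have "\<dots> = C * ?Y * infsum G (R j)"
      using C0 Y0 G0 by (intro real_sqrt_pow2 mult_nonneg_nonneg infsum_nonneg) auto
    finally show ?thesis .
  qed
  have sumG'': "(\<lambda>j. C * ?Y * infsum G (R j)) summable_on UNIV"
    using sumG' by (rule summable_on_cmult_right)
  then show sumT2: "(\<lambda>j. (infsum ?T (R j))\<^sup>2) summable_on UNIV"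
    by (rule summable_on_comparison_test) (use sq in auto)
  have "(\<Sum>\<^sub>\<infinity>j. (infsum ?T (R j))\<^sup>2) \<le> (\<Sum>\<^sub>\<infinity>j. C * ?Y * infsum G (R j))"
    using sumT2 sumG'' sq by (rule infsum_mono)
  also have "\<dots> = C * ?Y * (\<Sum>\<^sub>\<infinity>j. infsum G (R j))" by (rule infsum_cmult_right')
  also have "\<dots> \<le> C * ?Y * (C * (?X * ?Z))" using totG C0 Y0 by (intro mult_left_mono) auto
  also have "\<dots> = C\<^sup>2 * (?X * ?Y * ?Z)" by (simp add: power2_eq_square mult_ac)
  finally show "(\<Sum>\<^sub>\<infinity>j. (infsum ?T (R j))\<^sup>2) \<le> C\<^sup>2 * (?X * ?Y * ?Z)" .
qed

subsection \<open>The resonant nonlinearity\<close>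

lemma bracket_ge_1: "1 \<le> bracket j"
  by (simp add: bracket_def)

lemma bracket_nonneg [simp]: "0 \<le> bracket j"
  by (simp add: bracket_def)

lemma bracket_sq: "(bracket j)\<^sup>2 = 1 + of_int (sqlen j)"
  by (simp add: bracket_def)

text \<open>\<open>r\<close> is at most twice the larger of \<open>p\<close> and \<open>q\<close>.
  The hypothesis is in squares because squared brackets are affine in \<open>sqlen\<close>.\<close>

lemma powr_le_of_sq_le:
  fixes r p q s :: real
  assumes s: "s \<ge> 0" and pos: "r \<ge> 0" "p \<ge> 0" "q \<ge> 0" and le: "r\<^sup>2 \<le> 2 * (p\<^sup>2 + q\<^sup>2)"
  shows "r powr s \<le> 2 powr s * (p powr s + q powr s)"
proof -
  let ?m = "max p q"
  have "p\<^sup>2 \<le> ?m\<^sup>2" "q\<^sup>2 \<le> ?m\<^sup>2" using pos by (auto intro: power_mono)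
  then have "r\<^sup>2 \<le> (2 * ?m)\<^sup>2" using le by (simp add: power_mult_distrib)
  then have "r \<le> 2 * ?m" by (rule power2_le_imp_le) (use pos in \<open>simp add: le_max_iff_disj\<close>)
  then have "r powr s \<le> (2 * ?m) powr s" using pos s by (intro powr_mono2) auto
  also have "\<dots> = 2 powr s * ?m powr s" using pos by (simp add: powr_mult)
  also have "\<dots> \<le> 2 powr s * (p powr s + q powr s)" by (simp add: max_def)
  finally show ?thesis .
qed

lemma R_bracket_le:
  assumes s: "s \<ge> 0" and R: "(j1, j2, j3) \<in> R j"
  shows "bracket j powr s \<le> 2 powr s * (bracket j1 powr s + bracket j3 powr s)"
proof (rule powr_le_of_sq_le[OF s])
  have "sqlen j1 - sqlen j2 + sqlen j3 = sqlen j" using R by (simp add: R_def)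
  \<comment> \<open>The \<open>3\<close> is \<open>4 - 1\<close>, from the ones inside the brackets:
    four on the right of the target inequality, one on the left.\<close>
  then have "sqlen j \<le> 2 * sqlen j1 + 2 * sqlen j3 + 3"
    using sqlen_nonneg[of j1] sqlen_nonneg[of j2] sqlen_nonneg[of j3] by linarith
  then have "real_of_int (sqlen j) \<le> of_int (2 * sqlen j1 + 2 * sqlen j3 + 3)"
    by (simp only: of_int_le_iff)
  then show "(bracket j)\<^sup>2 \<le> 2 * ((bracket j1)\<^sup>2 + (bracket j3)\<^sup>2)"
    by (simp add: bracket_sq)
qed simp_all

text \<open>The shorter side is at most each of the two sides at \<open>j2\<close>. The first bound
  spares \<open>j1\<close> and the second spares \<open>j3\<close>, so that the index carrying the
  derivatives is never charged again. The parameter is \<open>\<beta> / 2\<close> because the weight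
  is a power of a squared length.\<close>

lemma side_weight_ge:
  assumes \<beta>: "\<beta> \<ge> 0"
  shows "1 \<le> 2 powr \<beta> * side_weight (\<beta> / 2) (j1, j2, j3) * (bracket j2 powr \<beta> + bracket j3 powr \<beta>)"
    and "1 \<le> 2 powr \<beta> * side_weight (\<beta> / 2) (j1, j2, j3) * (bracket j1 powr \<beta> + bracket j2 powr \<beta>)"
proof -
  define m where "m = min (sqlen (j1 - j2)) (sqlen (j3 - j2))"
  define r where "r = sqrt (1 + of_int m)"
  have m0: "0 \<le> m" by (simp add: m_def)
  have r1: "1 \<le> r" using m0 by (simp add: r_def)
  have r2: "r\<^sup>2 = 1 + of_int m" using m0 by (simp add: r_def)
  have w: "side_weight (\<beta> / 2) (j1, j2, j3) = inverse (r powr \<beta>)"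
  proof -
    have "side_weight (\<beta> / 2) (j1, j2, j3) = (r\<^sup>2) powr - (\<beta> / 2)"
      by (simp add: side_weight_def r2 m_def)
    also have "\<dots> = r powr - \<beta>" using r1 by (simp add: powr_powr flip: powr_numeral)
    finally show ?thesis by (simp add: powr_minus)
  qed
  have *: "1 \<le> 2 powr \<beta> * side_weight (\<beta> / 2) (j1, j2, j3) * (bracket p powr \<beta> + bracket q powr \<beta>)"
    if "m \<le> 2 * (sqlen p + sqlen q)" for p q
  proof -
    have "real_of_int m \<le> of_int (2 * (sqlen p + sqlen q))" using that by (simp only: of_int_le_iff)
    then have "r\<^sup>2 \<le> 2 * ((bracket p)\<^sup>2 + (bracket q)\<^sup>2)" by (simp add: r2 bracket_sq)
    then have "r powr \<beta> \<le> 2 powr \<beta> * (bracket p powr \<beta> + bracket q powr \<beta>)"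
      using \<beta> r1 bracket_ge_1[of p] bracket_ge_1[of q] by (intro powr_le_of_sq_le) auto
    then show ?thesis using r1 by (simp add: w field_simps)
  qed
  show "1 \<le> 2 powr \<beta> * side_weight (\<beta> / 2) (j1, j2, j3) * (bracket j2 powr \<beta> + bracket j3 powr \<beta>)"
    using sqlen_diff_le[of j3 j2] by (intro *) (simp add: m_def add.commute min_le_iff_disj)
  show "1 \<le> 2 powr \<beta> * side_weight (\<beta> / 2) (j1, j2, j3) * (bracket j1 powr \<beta> + bracket j2 powr \<beta>)"
    using sqlen_diff_le[of j1 j2] by (intro *) (simp add: m_def min_le_iff_disj)
qed

section \<open>From termwise bounds to norm bounds\<close>

lemma sum4_sq_le:
  fixes a b c d :: real
  shows "(a + b + c + d)\<^sup>2 \<le> 4 * (a\<^sup>2 + b\<^sup>2 + c\<^sup>2 + d\<^sup>2)"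
proof -
  have "4 * (a\<^sup>2 + b\<^sup>2 + c\<^sup>2 + d\<^sup>2) - (a + b + c + d)\<^sup>2
      = (a - b)\<^sup>2 + (a - c)\<^sup>2 + (a - d)\<^sup>2 + (b - c)\<^sup>2 + (b - d)\<^sup>2 + (c - d)\<^sup>2"
    by (simp add: power2_eq_square algebra_simps)
  then show ?thesis by (smt (verit) zero_le_power2)
qed

text \<open>Derivatives on \<open>j1\<close> leave \<open>j2\<close> or \<open>j3\<close> to carry
  the power \<open>\<beta>\<close>, and derivatives on \<open>j3\<close> leave \<open>j1\<close> or
  \<open>j2\<close>. These are the four terms; \<open>S\<close>, \<open>B\<close> and
  \<open>n\<close> occur once in each.\<close>

lemma F_term_bound:
  fixes a :: "Z2 \<Rightarrow> complex"
  assumes s: "s \<ge> 0" and \<beta>: "\<beta> \<ge> 0" and t: "t \<in> R j"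
  defines "n \<equiv> \<lambda>q. cmod (a q)"
  defines "S \<equiv> \<lambda>q. bracket q powr s * n q" and "B \<equiv> \<lambda>q. bracket q powr \<beta> * n q"
  shows "bracket j powr s * cmod (F_term a t) \<le> 2 powr (s + \<beta>) *
    (trilinear_term (\<beta> / 2) S B n t + trilinear_term (\<beta> / 2) S n B t
     + trilinear_term (\<beta> / 2) B n S t + trilinear_term (\<beta> / 2) n B S t)"
proof -
  obtain j1 j2 j3 where eq: "t = (j1, j2, j3)" by (metis surj_pair)
  define w where "w = side_weight (\<beta> / 2) (j1, j2, j3)"
  define b where "b = (\<lambda>q. bracket q powr \<beta>)"
  let ?N = "n j1 * n j2 * n j3"
  have N0: "0 \<le> ?N" "0 \<le> S j1 * n j2 * n j3" "0 \<le> n j1 * n j2 * S j3" by (simp_all add: n_def S_def)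
  have "bracket j powr s * ?N \<le> (2 powr s * (bracket j1 powr s + bracket j3 powr s)) * ?N"
    using R_bracket_le[OF s] t N0(1) unfolding eq by (intro mult_right_mono) auto
  also have "\<dots> = 2 powr s * (1 * (S j1 * n j2 * n j3) + 1 * (n j1 * n j2 * S j3))"
    by (simp add: S_def algebra_simps)
  \<comment> \<open>Each explicit \<open>1\<close> is replaced by the bound of
    \<open>side_weight_ge\<close> that avoids the index carrying \<open>S\<close>.\<close>
  also have "\<dots> \<le> 2 powr s * ((2 powr \<beta> * w * (b j2 + b j3)) * (S j1 * n j2 * n j3)
      + (2 powr \<beta> * w * (b j1 + b j2)) * (n j1 * n j2 * S j3))"
    using side_weight_ge[OF \<beta>, of j1 j2 j3] N0 unfolding w_def b_def
    by (intro mult_left_mono add_mono mult_right_mono) auto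
  also have "\<dots> = 2 powr (s + \<beta>) *
    (trilinear_term (\<beta> / 2) S B n t + trilinear_term (\<beta> / 2) S n B t
     + trilinear_term (\<beta> / 2) B n S t + trilinear_term (\<beta> / 2) n B S t)"
    by (simp add: eq trilinear_term_def w_def b_def B_def powr_add algebra_simps)
  finally show ?thesis by (simp add: eq F_term_def n_def norm_mult)
qed

text \<open>Keeping \<open>s\<close> general treats both inequalities at once. The four majorants
  all have the same product of three norms as their bound.\<close>

lemma F_h_bound:
  fixes s \<beta> :: real
  assumes s: "s \<ge> 0" and \<beta>: "\<beta> > 0"
  shows "\<exists>C\<ge>0. \<forall>a. in_h s a \<and> in_h \<beta> a \<and> in_l2 a \<longrightarrow>
    F_defined a \<and> in_h s (F a) \<and> h_norm s (F a) \<le> C * h_norm s a * h_norm \<beta> a * l2_norm a"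
proof -
  obtain C where C0: "C \<ge> 0"
    and C: "\<And>v. (\<Sum>k\<in>thales v. (1 + of_int (side_sq v k)) powr -(\<beta> / 2)) \<le> C"
    using sum_thales_bound[of "\<beta> / 2"] \<beta> by auto
  define K where "K = (2::real) powr (s + \<beta>)"
  have K0: "K \<ge> 0" by (simp add: K_def)
  have "F_defined a \<and> in_h s (F a) \<and> h_norm s (F a) \<le> (4 * K * C) * h_norm s a * h_norm \<beta> a * l2_norm a"
    if a: "in_h s a" "in_h \<beta> a" "in_l2 a" for a
  proof -
    define n where "n = (\<lambda>q. cmod (a q))"
    define S where "S = (\<lambda>q. bracket q powr s * n q)"
    define B where "B = (\<lambda>q. bracket q powr \<beta> * n q)"
    have sq: "(bracket q powr r * c)\<^sup>2 = bracket q powr (2 * r) * c\<^sup>2" for q r c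
    proof -
      have "(bracket q powr r)\<^sup>2 = bracket q powr (2 * r)" by (simp add: power2_eq_square flip: powr_add)
      then show ?thesis by (simp add: power_mult_distrib)
    qed
    have nonneg: "0 \<le> n q" "0 \<le> S q" "0 \<le> B q" for q by (simp_all add: n_def S_def B_def)
    have summ: "(\<lambda>q. (n q)\<^sup>2) summable_on UNIV" "(\<lambda>q. (S q)\<^sup>2) summable_on UNIV"
      "(\<lambda>q. (B q)\<^sup>2) summable_on UNIV"
      using a by (simp_all add: in_l2_def in_h_def n_def S_def B_def sq)
    let ?n = "\<Sum>\<^sub>\<infinity>q. (n q)\<^sup>2" and ?S = "\<Sum>\<^sub>\<infinity>q. (S q)\<^sup>2" and ?B = "\<Sum>\<^sub>\<infinity>q. (B q)\<^sup>2"
    have norms: "l2_norm a = sqrt ?n" "h_norm s a = sqrt ?S" "h_norm \<beta> a = sqrt ?B"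
      by (simp_all add: l2_norm_def h_norm_def n_def S_def B_def sq)
    have pos: "0 \<le> ?n" "0 \<le> ?S" "0 \<le> ?B" by (simp_all add: infsum_nonneg)
    let ?T1 = "trilinear_term (\<beta> / 2) S B n" and ?T2 = "trilinear_term (\<beta> / 2) S n B"
    let ?T3 = "trilinear_term (\<beta> / 2) B n S" and ?T4 = "trilinear_term (\<beta> / 2) n B S"
    note b1 = trilinear_bound[OF C nonneg(2,3,1) summ(2,3,1)]
    note b2 = trilinear_bound[OF C nonneg(2,1,3) summ(2,1,3)]
    note b3 = trilinear_bound[OF C nonneg(3,1,2) summ(3,1,2)]
    note b4 = trilinear_bound[OF C nonneg(1,3,2) summ(1,3,2)]
    let ?T = "\<lambda>t. K * (?T1 t + ?T2 t + ?T3 t + ?T4 t)"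
    have sumT: "?T summable_on R j" for j
      by (intro summable_on_cmult_right summable_on_add b1 b2 b3 b4)
    have ptw: "bracket j powr s * cmod (F_term a t) \<le> ?T t" if "t \<in> R j" for j t
      using F_term_bound[OF s less_imp_le[OF \<beta>] that, of a] unfolding K_def n_def S_def B_def .
    \<comment> \<open>Since the bracket power is at least \<open>1\<close>, the majorant of the
      weighted terms also dominates the unweighted ones, which makes \<open>F a\<close> well
      defined.\<close>
    have "1 \<le> bracket j powr s" for j using bracket_ge_1 s by (rule ge_one_powr_ge_zero)
    then have "cmod (F_term a t) \<le> ?T t" if "t \<in> R j" for j t
      using ptw[OF that] mult_right_mono[of 1 "bracket j powr s" "cmod (F_term a t)"] by simp
    then have absF: "(\<lambda>t. cmod (F_term a t)) summable_on R j" for j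
      by (rule Infinite_Sum.abs_summable_on_comparison_test'[OF sumT])
    then have "F_defined a" unfolding F_defined_def by (blast intro: Infinite_Sum.abs_summable_summable)
    let ?\<tau> = "\<lambda>T j. (\<Sum>\<^sub>\<infinity>t\<in>R j. T t)"
    let ?U = "\<lambda>j. (?\<tau> ?T1 j)\<^sup>2 + (?\<tau> ?T2 j)\<^sup>2 + (?\<tau> ?T3 j)\<^sup>2 + (?\<tau> ?T4 j)\<^sup>2"
    have Fj: "(bracket j powr s * cmod (F a j))\<^sup>2 \<le> K\<^sup>2 * 4 * ?U j" for j
    proof -
      have "bracket j powr s * cmod (F a j) \<le> bracket j powr s * (\<Sum>\<^sub>\<infinity>t\<in>R j. cmod (F_term a t))"
        unfolding F_def by (intro mult_left_mono norm_infsum_bound absF) simp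
      also have "\<dots> = (\<Sum>\<^sub>\<infinity>t\<in>R j. bracket j powr s * cmod (F_term a t))"
        by (rule infsum_cmult_right'[symmetric])
      also have "\<dots> \<le> (\<Sum>\<^sub>\<infinity>t\<in>R j. ?T t)"
        by (rule infsum_mono[OF summable_on_cmult_right[OF absF] sumT ptw])
      also have "\<dots> = K * (?\<tau> ?T1 j + ?\<tau> ?T2 j + ?\<tau> ?T3 j + ?\<tau> ?T4 j)"
        by (simp add: infsum_cmult_right' infsum_add summable_on_add b1(1) b2(1) b3(1) b4(1))
      finally have "(bracket j powr s * cmod (F a j))\<^sup>2
          \<le> (K * (?\<tau> ?T1 j + ?\<tau> ?T2 j + ?\<tau> ?T3 j + ?\<tau> ?T4 j))\<^sup>2"
        by (rule power_mono) simp
      also have "\<dots> = K\<^sup>2 * (?\<tau> ?T1 j + ?\<tau> ?T2 j + ?\<tau> ?T3 j + ?\<tau> ?T4 j)\<^sup>2"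
        by (rule power_mult_distrib)
      also have "\<dots> \<le> K\<^sup>2 * (4 * ?U j)" by (intro mult_left_mono sum4_sq_le) simp
      finally show ?thesis by (simp only: mult.assoc)
    qed
    have sumU: "(\<lambda>j. K\<^sup>2 * 4 * ?U j) summable_on UNIV"
      by (intro summable_on_cmult_right summable_on_add b1 b2 b3 b4)
    then have sumF: "(\<lambda>j. (bracket j powr s * cmod (F a j))\<^sup>2) summable_on UNIV"
      by (rule summable_on_comparison_test) (use Fj in auto)
    then have "in_h s (F a)" by (simp add: in_h_def sq)
    have "(\<Sum>\<^sub>\<infinity>j. (bracket j powr s * cmod (F a j))\<^sup>2) \<le> (\<Sum>\<^sub>\<infinity>j. K\<^sup>2 * 4 * ?U j)"
      using sumF sumU Fj by (rule infsum_mono)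
    also have "\<dots> = K\<^sup>2 * 4 * ((\<Sum>\<^sub>\<infinity>j. (?\<tau> ?T1 j)\<^sup>2) + (\<Sum>\<^sub>\<infinity>j. (?\<tau> ?T2 j)\<^sup>2)
        + (\<Sum>\<^sub>\<infinity>j. (?\<tau> ?T3 j)\<^sup>2) + (\<Sum>\<^sub>\<infinity>j. (?\<tau> ?T4 j)\<^sup>2))"
      by (simp add: infsum_cmult_right' infsum_add summable_on_add b1(2) b2(2) b3(2) b4(2))
    also have "\<dots> \<le> K\<^sup>2 * 4 * (C\<^sup>2 * (?S * ?B * ?n) + C\<^sup>2 * (?S * ?n * ?B)
        + C\<^sup>2 * (?B * ?n * ?S) + C\<^sup>2 * (?n * ?B * ?S))"
      by (intro mult_left_mono add_mono b1 b2 b3 b4) simp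
    \<comment> \<open>The four products agree up to order; their number, times the \<open>4\<close>
      from \<open>sum4_sq_le\<close>, gives \<open>4\<^sup>2\<close>.\<close>
    also have "\<dots> = (4 * K * C)\<^sup>2 * (?S * ?B * ?n)" by (simp add: power_mult_distrib algebra_simps)
    finally have "h_norm s (F a) \<le> sqrt ((4 * K * C)\<^sup>2 * (?S * ?B * ?n))"
      by (simp add: h_norm_def sq)
    also have "\<dots> = (4 * K * C) * h_norm s a * h_norm \<beta> a * l2_norm a"
      using K0 C0 by (simp add: norms real_sqrt_mult)
    finally show ?thesis using \<open>F_defined a\<close> \<open>in_h s (F a)\<close> by blast
  qed
  moreover have "0 \<le> 4 * K * C" using K0 C0 by simp
  ultimately show ?thesis by blast
qed

section \<open>The exponents \<open>0\<close> and \<open>1\<close>\<close>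

lemma bracket_neq_0: "bracket j \<noteq> 0"
  using bracket_ge_1[of j] by simp

text \<open>As \<open>0 powr 0 = 0\<close>, it is the nonvanishing of the bracket that turns the
  weight with exponent \<open>0\<close> into \<open>1\<close>.\<close>

lemma in_h_0: "in_h 0 a \<longleftrightarrow> in_l2 a"
  by (simp add: in_h_def in_l2_def bracket_neq_0)

lemma h_norm_0: "h_norm 0 a = l2_norm a"
  by (simp add: h_norm_def l2_norm_def bracket_neq_0)

lemma h_norm_nonneg: "0 \<le> h_norm s a"
  by (simp add: h_norm_def infsum_nonneg)

lemma l2_norm_nonneg: "0 \<le> l2_norm a"
  by (simp add: l2_norm_def infsum_nonneg)

theorem lemma3p1:
  fixes \<beta> :: real
  assumes "\<beta> > 0"
  shows "\<exists>C::real. \<forall>a :: Z2 \<Rightarrow> complex.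
    (in_l2 a \<and> in_h \<beta> a \<longrightarrow>
       F_defined a \<and> in_l2 (F a) \<and>
       l2_norm (F a) \<le> C * (l2_norm a)\<^sup>2 * h_norm \<beta> a) \<and>
    (in_h 1 a \<and> in_h \<beta> a \<and> in_l2 a \<longrightarrow>
       F_defined a \<and> in_h 1 (F a) \<and>
       h_norm 1 (F a) \<le> C * h_norm 1 a * h_norm \<beta> a * l2_norm a)"
proof -
  \<comment> \<open>For \<open>s = 0\<close> the first norm is again the \<open>l2\<close> norm, so
    that two equal factors form the square.\<close>
  obtain C0 where C0: "C0 \<ge> 0" "\<And>a. in_h 0 a \<and> in_h \<beta> a \<and> in_l2 a \<longrightarrow>
    F_defined a \<and> in_h 0 (F a) \<and> h_norm 0 (F a) \<le> C0 * h_norm 0 a * h_norm \<beta> a * l2_norm a"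
    using F_h_bound[OF order_refl assms] by blast
  obtain C1 where C1: "C1 \<ge> 0" "\<And>a. in_h 1 a \<and> in_h \<beta> a \<and> in_l2 a \<longrightarrow>
    F_defined a \<and> in_h 1 (F a) \<and> h_norm 1 (F a) \<le> C1 * h_norm 1 a * h_norm \<beta> a * l2_norm a"
    using F_h_bound[OF zero_le_one assms] by blast
  \<comment> \<open>Both constants are nonnegative, so their sum serves for both estimates.\<close>
  have le: "c * h_norm s a * h_norm \<beta> a * l2_norm a \<le> (C0 + C1) * h_norm s a * h_norm \<beta> a * l2_norm a"
    if "c \<le> C0 + C1" for c s a
    using that by (intro mult_right_mono h_norm_nonneg l2_norm_nonneg)
  show ?thesis
  proof (intro exI[of _ "C0 + C1"] allI conjI[of "_ \<longrightarrow> _"] impI)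
    fix a assume "in_l2 a \<and> in_h \<beta> a"
    then have "F_defined a \<and> in_l2 (F a) \<and> l2_norm (F a) \<le> C0 * h_norm 0 a * h_norm \<beta> a * l2_norm a"
      using C0(2)[of a] by (simp add: in_h_0 h_norm_0)
    moreover have "(C0 + C1) * h_norm 0 a * h_norm \<beta> a * l2_norm a
        = (C0 + C1) * (l2_norm a)\<^sup>2 * h_norm \<beta> a"
      by (simp add: h_norm_0 power2_eq_square)
    ultimately show "F_defined a \<and> in_l2 (F a) \<and>
        l2_norm (F a) \<le> (C0 + C1) * (l2_norm a)\<^sup>2 * h_norm \<beta> a"
      using le[of C0 0 a] C1(1) by linarith
  next
    fix a assume "in_h 1 a \<and> in_h \<beta> a \<and> in_l2 a"
    then show "F_defined a \<and> in_h 1 (F a) \<and>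
        h_norm 1 (F a) \<le> (C0 + C1) * h_norm 1 a * h_norm \<beta> a * l2_norm a"
      using C1(2)[of a] le[of C1 1 a] C0(1) by linarith
  qed
qed

end
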